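(* Let $X$ be a compactum. A functional $\mu:C(X,[0,1])\to[0,1]$ is $\vee$-homogeneous and $\wedge$-homogeneous if and only if there exists a unique capacity $\nu$ on $X$ such that $\mu$ is the Sugeno integral with respect to $\nu$, that is, $$\mu(f)=\max\{\nu(f^{-1}([t,1]))\wedge t\mid t\in[0,1]\}\quad\text{for all } f\in C(X,[0,1]).$$
   Context: A compactum is a compact Hausdorff space. $C(X,[0,1])$ is the set of continuous functions $X\to[0,1]$ with pointwise lattice operations $\vee$ (maximum) and $\wedge$ (minimum); on $[0,1]$, $s\vee t=\max\{s,t\}$ and $s\wedge t=\min\{s,t\}$. For $c\in[0,1]$, $c_X$ is the constant function on $X$ with value $c$. A functional $\mu:C(X,[0,1])\to[0,1]$ (an arbitrary map) is $\vee$-homogeneous if $\mu(c_X\vee\varphi)=c\vee\mu(\varphi)$, and $\wedge$-homogeneous if $\mu(c_X\wedge\varphi)=c\wedge\mu(\varphi)$, for all $c\in[0,1]$ and $\varphi\in C(X,[0,1])$. Let $\mathcal F(X)$ be the family of all closed subsets of $X$ (including $\emptyset$). A capacity (upper-semicontinuous capacity) on $X$ is a function $\nu:\mathcal F(X)\to[0,1]$ such that for all closed $F,G\subset X$: (1) $\nu(X)=1$, $\nu(\emptyset)=0$; (2) $F\subset G$ implies $\nu(F)\le\nu(G)$; (3) if $\nu(F)<a$ for some $a\in[0,1]$, then there exists an open set $O\supset F$ such that $\nu(B)<a$ for each compact set $B\subset O$. *)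

theory Defs
  imports "HOL-Analysis.Analysis"
begin

text \<open>
  A compactum is a topology \<open>X\<close> with \<^term>\<open>compact_space X\<close> and \<^term>\<open>Hausdorff_space X\<close>.
  Functions on the points of \<open>X\<close> and functions on the closed subsets of \<open>X\<close> are represented
  extensionally, i.e. with the fixed value \<^term>\<open>undefined\<close> outside their domain. Thus a functional
  on \<open>C(X,[0,1])\<close> sees only the restriction of its argument to the points of \<open>X\<close>, and uniqueness of
  a capacity means uniqueness of its values on closed sets.
\<close>

definition unit_functions :: "'a topology \<Rightarrow> ('a \<Rightarrow> real) set" where
  "unit_functions X =
     {f. continuous_map X (top_of_set {0..1}) f \<and> f \<in> extensional (topspace X)}"

definition const_fun :: "'a topology \<Rightarrow> real \<Rightarrow> 'a \<Rightarrow> real" where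
  "const_fun X c = (\<lambda>x\<in>topspace X. c)"

definition join_fun :: "'a topology \<Rightarrow> ('a \<Rightarrow> real) \<Rightarrow> ('a \<Rightarrow> real) \<Rightarrow> 'a \<Rightarrow> real" where
  "join_fun X f g = (\<lambda>x\<in>topspace X. max (f x) (g x))"

definition meet_fun :: "'a topology \<Rightarrow> ('a \<Rightarrow> real) \<Rightarrow> ('a \<Rightarrow> real) \<Rightarrow> 'a \<Rightarrow> real" where
  "meet_fun X f g = (\<lambda>x\<in>topspace X. min (f x) (g x))"

definition join_homogeneous :: "'a topology \<Rightarrow> (('a \<Rightarrow> real) \<Rightarrow> real) \<Rightarrow> bool" where
  "join_homogeneous X \<mu> \<longleftrightarrow>
     (\<forall>c\<in>{0..1}. \<forall>f\<in>unit_functions X. \<mu> (join_fun X (const_fun X c) f) = max c (\<mu> f))"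

definition meet_homogeneous :: "'a topology \<Rightarrow> (('a \<Rightarrow> real) \<Rightarrow> real) \<Rightarrow> bool" where
  "meet_homogeneous X \<mu> \<longleftrightarrow>
     (\<forall>c\<in>{0..1}. \<forall>f\<in>unit_functions X. \<mu> (meet_fun X (const_fun X c) f) = min c (\<mu> f))"

definition capacity :: "'a topology \<Rightarrow> ('a set \<Rightarrow> real) \<Rightarrow> bool" where
  "capacity X \<nu> \<longleftrightarrow>
     \<nu> \<in> {F. closedin X F} \<rightarrow>\<^sub>E {0..1} \<and>
     \<nu> (topspace X) = 1 \<and> \<nu> {} = 0 \<and>
     (\<forall>F G. closedin X F \<and> closedin X G \<and> F \<subseteq> G \<longrightarrow> \<nu> F \<le> \<nu> G) \<and>
     (\<forall>F. \<forall>a\<in>{0..1}. closedin X F \<and> \<nu> F < a \<longrightarrow>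
        (\<exists>U. openin X U \<and> F \<subseteq> U \<and> (\<forall>B. compactin X B \<and> B \<subseteq> U \<longrightarrow> \<nu> B < a)))"

text \<open>The library's \<^const>\<open>Max\<close> is meaningful only for finite sets.\<close>

definition is_maximum :: "real set \<Rightarrow> real \<Rightarrow> bool" where
  "is_maximum S m \<longleftrightarrow> m \<in> S \<and> (\<forall>s\<in>S. s \<le> m)"

definition is_Sugeno_integral ::
    "'a topology \<Rightarrow> ('a set \<Rightarrow> real) \<Rightarrow> (('a \<Rightarrow> real) \<Rightarrow> real) \<Rightarrow> bool" where
  "is_Sugeno_integral X \<nu> \<mu> \<longleftrightarrow>
     (\<forall>f\<in>unit_functions X.
        is_maximum ((\<lambda>t. min (\<nu> (f -` {t..1} \<inter> topspace X)) t) ` {0..1}) (\<mu> f))"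

end

theory Submission
  imports Defs
begin

text \<open>
  Homogeneity alone forces monotonicity: if \<open>f \<le> g\<close> but \<open>\<mu> g < m < \<mu> f\<close>, then the median \<open>h\<close> of
  \<open>f\<close>, \<open>m\<close>, \<open>g\<close> satisfies \<open>h \<and> m = g \<and> m\<close> and \<open>h \<or> m = f \<or> m\<close>, so \<open>\<mu> h\<close> would have to be both below
  and above \<open>m\<close>. The capacity is then \<open>\<nu> F = inf {\<mu> f | f = 1 on F}\<close>. Its basic estimate is
  \<open>\<nu> {f \<ge> s} \<le> \<mu> f\<close> for \<open>s > \<mu> f\<close>: a function that is \<open>1\<close> on \<open>{f \<ge> s}\<close> and \<open>0\<close> on \<open>{f \<le> b}\<close>, where
  \<open>\<mu> f < b < s\<close>, lies below \<open>f\<close> after truncation at height \<open>b\<close>. Conversely, the Sugeno integral is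
  characterised by \<open>\<mu> f \<ge> t\<close> iff \<open>\<nu> {f \<ge> t} \<ge> t\<close>, which gives homogeneity; uniqueness follows by
  Urysohn's lemma.
\<close>

section \<open>Unit-valued continuous functions\<close>

lemma unit_functions_iff:
  "f \<in> unit_functions X \<longleftrightarrow>
     continuous_map X euclideanreal f \<and> (\<forall>x\<in>topspace X. 0 \<le> f x \<and> f x \<le> 1) \<and>
     f \<in> extensional (topspace X)"
  by (auto simp: unit_functions_def continuous_map_in_subtopology)

lemma unit_functionsD:
  assumes "f \<in> unit_functions X"
  shows "continuous_map X euclideanreal f"
    and "\<And>x. x \<in> topspace X \<Longrightarrow> 0 \<le> f x" and "\<And>x. x \<in> topspace X \<Longrightarrow> f x \<le> 1"
  using assms by (auto simp: unit_functions_iff)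

lemma restrict_unit_functions:
  assumes "continuous_map X euclideanreal g"
    and "\<And>x. x \<in> topspace X \<Longrightarrow> 0 \<le> g x \<and> g x \<le> 1"
  shows "restrict g (topspace X) \<in> unit_functions X"
  using assms by (auto simp: unit_functions_iff intro: continuous_map_eq)

lemma const_unit_functions: "c \<in> {0..1} \<Longrightarrow> const_fun X c \<in> unit_functions X"
  unfolding const_fun_def by (intro restrict_unit_functions) auto

lemma join_unit_functions:
  "f \<in> unit_functions X \<Longrightarrow> g \<in> unit_functions X \<Longrightarrow> join_fun X f g \<in> unit_functions X"
  unfolding join_fun_def
  by (intro restrict_unit_functions continuous_map_real_max)
     (auto dest: unit_functionsD simp: max_def)

lemma meet_unit_functions:
  "f \<in> unit_functions X \<Longrightarrow> g \<in> unit_functions X \<Longrightarrow> meet_fun X f g \<in> unit_functions X"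
  unfolding meet_fun_def
  by (intro restrict_unit_functions continuous_map_real_min)
     (auto dest: unit_functionsD simp: min_def)

lemma unit_functions_eqI:
  "f \<in> unit_functions X \<Longrightarrow> g \<in> unit_functions X \<Longrightarrow> (\<And>x. x \<in> topspace X \<Longrightarrow> f x = g x) \<Longrightarrow> f = g"
  by (auto simp: unit_functions_iff intro: extensionalityI)

lemmas unit_functions_closure = const_unit_functions join_unit_functions meet_unit_functions

section \<open>Level sets and cut-off functions\<close>

lemma unit_fun_upper_set_eq:
  "f \<in> unit_functions X \<Longrightarrow> f -` {t..1} \<inter> topspace X = {x \<in> topspace X. t \<le> f x}"
  by (auto dest: unit_functionsD)

lemma closedin_upper_set:
  "f \<in> unit_functions X \<Longrightarrow> closedin X {x \<in> topspace X. t \<le> f x}"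
  using closedin_continuous_map_preimage[of X euclideanreal f "{t..}"]
  by (auto dest: unit_functionsD)

lemma closedin_lower_set:
  "f \<in> unit_functions X \<Longrightarrow> closedin X {x \<in> topspace X. f x \<le> t}"
  using closedin_continuous_map_preimage[of X euclideanreal f "{..t}"]
  by (auto dest: unit_functionsD)

lemma openin_strict_upper_set:
  "f \<in> unit_functions X \<Longrightarrow> openin X {x \<in> topspace X. t < f x}"
  using openin_continuous_map_preimage[of X euclideanreal f "{t<..}"]
  by (auto dest: unit_functionsD)

lemma unit_function_threshold:
  fixes b s :: real
  assumes f: "f \<in> unit_functions X" and "b < s"
  obtains k where "k \<in> unit_functions X"
    and "\<And>x. x \<in> topspace X \<Longrightarrow> s \<le> f x \<Longrightarrow> k x = 1"
    and "\<And>x. x \<in> topspace X \<Longrightarrow> f x \<le> b \<Longrightarrow> k x = 0"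
proof
  let ?k = "\<lambda>x\<in>topspace X. max 0 (min 1 ((f x - b) / (s - b)))"
  show "?k \<in> unit_functions X"
    by (intro restrict_unit_functions continuous_map_real_max continuous_map_real_min
        continuous_map_real_divide continuous_map_diff unit_functionsD[OF f])
       (use \<open>b < s\<close> in auto)
  show "?k x = 1" if "x \<in> topspace X" "s \<le> f x" for x
    using that \<open>b < s\<close> by (auto simp: max_def min_def field_simps)
  show "?k x = 0" if "x \<in> topspace X" "f x \<le> b" for x
    using that \<open>b < s\<close> by (auto simp: max_def min_def field_simps)
qed

text \<open>The constant \<open>1\<close> always competes, so for nonnegative \<open>\<mu>\<close>
  this is a genuine real infimum. The restriction to closed sets supplies the extensionality that
  \<open>capacity\<close> demands.\<close>

definition induced_capacity :: "'a topology \<Rightarrow> (('a \<Rightarrow> real) \<Rightarrow> real) \<Rightarrow> 'a set \<Rightarrow> real" where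
  "induced_capacity X \<mu> =
     (\<lambda>F\<in>{F. closedin X F}. INF f\<in>{f \<in> unit_functions X. \<forall>x\<in>F. f x = 1}. \<mu> f)"

section \<open>The capacity of a homogeneous functional\<close>

locale homogeneous_functional =
  fixes X :: "'a topology" and \<mu> :: "('a \<Rightarrow> real) \<Rightarrow> real"
  assumes compact: "compact_space X" and Hausdorff: "Hausdorff_space X"
    and range: "\<mu> \<in> unit_functions X \<rightarrow> {0..1}"
    and join: "join_homogeneous X \<mu>" and meet: "meet_homogeneous X \<mu>"
begin

abbreviation \<nu> where "\<nu> \<equiv> induced_capacity X \<mu>"

lemma range_bounds: "f \<in> unit_functions X \<Longrightarrow> 0 \<le> \<mu> f \<and> \<mu> f \<le> 1"
  using range by auto

lemma \<mu>_join: "c \<in> {0..1} \<Longrightarrow> f \<in> unit_functions X \<Longrightarrow> \<mu> (join_fun X (const_fun X c) f) = max c (\<mu> f)"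
  using join by (auto simp: join_homogeneous_def)

lemma \<mu>_meet: "c \<in> {0..1} \<Longrightarrow> f \<in> unit_functions X \<Longrightarrow> \<mu> (meet_fun X (const_fun X c) f) = min c (\<mu> f)"
  using meet by (auto simp: meet_homogeneous_def)

text \<open>Meeting with the constant \<open>0\<close> forces \<open>\<mu>\<close> to vanish there;
  joining that function with \<open>c\<close> then gives \<open>max c 0 = c\<close>.\<close>

lemma \<mu>_const:
  assumes "c \<in> {0..1}" shows "\<mu> (const_fun X c) = c"
proof -
  have 0: "const_fun X 0 \<in> unit_functions X" and 1: "const_fun X 1 \<in> unit_functions X"
    by (auto intro: const_unit_functions)
  have "meet_fun X (const_fun X 0) (const_fun X 0) = const_fun X 0"
    and "join_fun X (const_fun X c) (const_fun X 0) = const_fun X c"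
    using assms by (auto simp: meet_fun_def join_fun_def const_fun_def)
  then show ?thesis
    using \<mu>_meet[OF _ 0, of 0] \<mu>_join[OF assms 0] range_bounds[OF 0] assms by auto
qed

lemma \<mu>_mono:
  assumes f: "f \<in> unit_functions X" and g: "g \<in> unit_functions X"
    and le: "\<And>x. x \<in> topspace X \<Longrightarrow> f x \<le> g x"
  shows "\<mu> f \<le> \<mu> g"
proof (rule ccontr)
  assume "\<not> \<mu> f \<le> \<mu> g"
  then obtain m where m: "\<mu> g < m" "m < \<mu> f"
    using dense[of "\<mu> g" "\<mu> f"] by auto
  then have m01: "m \<in> {0..1}"
    using range_bounds[OF f] range_bounds[OF g] by auto
  \<comment> \<open>As \<open>f \<le> g\<close>, this formula is the median of \<open>f\<close>,
    \<open>m\<close> and \<open>g\<close>.\<close>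
  define h where "h = join_fun X f (meet_fun X (const_fun X m) g)"
  note unit = unit_functions_closure f g m01
  have h: "h \<in> unit_functions X"
    unfolding h_def by (intro unit)
  have "meet_fun X (const_fun X m) h = meet_fun X (const_fun X m) g"
  proof (rule unit_functions_eqI)
    fix x assume "x \<in> topspace X"
    then show "meet_fun X (const_fun X m) h x = meet_fun X (const_fun X m) g x"
      using le[of x] by (auto simp: h_def meet_fun_def join_fun_def const_fun_def)
  qed (intro unit h)+
  then have "min m (\<mu> h) = min m (\<mu> g)"
    using \<mu>_meet[OF m01 h] \<mu>_meet[OF m01 g] by simp
  moreover have "join_fun X (const_fun X m) h = join_fun X (const_fun X m) f"
    by (rule unit_functions_eqI[of _ X])
       (intro unit h, intro unit, auto simp: h_def meet_fun_def join_fun_def const_fun_def)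
  then have "max m (\<mu> h) = max m (\<mu> f)"
    using \<mu>_join[OF m01 h] \<mu>_join[OF m01 f] by simp
  \<comment> \<open>The meet equation forces \<open>\<mu> h = \<mu> g < m\<close>, the join equation
    \<open>\<mu> h = \<mu> f > m\<close>.\<close>
  ultimately show False
    using m by linarith
qed

section \<open>The induced capacity on level sets\<close>

lemma \<nu>_le:
  assumes "closedin X F" "f \<in> unit_functions X" "\<And>x. x \<in> F \<Longrightarrow> f x = 1"
  shows "\<nu> F \<le> \<mu> f"
proof -
  have "bdd_below (\<mu> ` {f \<in> unit_functions X. \<forall>x\<in>F. f x = 1})"
    using range_bounds by (intro bdd_belowI[of _ 0]) auto
  then show ?thesis
    using assms by (auto simp: induced_capacity_def intro!: cINF_lower)
qed

lemma \<nu>_greatest: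
  assumes F: "closedin X F"
    and "\<And>f. f \<in> unit_functions X \<Longrightarrow> (\<And>x. x \<in> F \<Longrightarrow> f x = 1) \<Longrightarrow> a \<le> \<mu> f"
  shows "a \<le> \<nu> F"
proof -
  have "const_fun X 1 \<in> {f \<in> unit_functions X. \<forall>x\<in>F. f x = 1}"
    using closedin_subset[OF F] const_unit_functions[of 1 X] by (auto simp: const_fun_def)
  then show ?thesis
    using assms by (auto simp: induced_capacity_def intro!: cINF_greatest)
qed

lemma \<nu>_mono:
  assumes "closedin X F" "closedin X G" "F \<subseteq> G"
  shows "\<nu> F \<le> \<nu> G"
  using assms by (intro \<nu>_greatest \<nu>_le) auto

text \<open>This is the basic estimate at the level of functions. Keeping the witness
  \<open>k\<close>, rather than only a bound on \<open>\<nu>\<close>, lets it serve both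
  inequalities between \<open>\<mu>\<close> and \<open>\<nu>\<close>.\<close>

lemma threshold_le:
  assumes g: "g \<in> unit_functions X" and s: "\<mu> g < s"
  obtains k where "k \<in> unit_functions X" "\<And>x. x \<in> topspace X \<Longrightarrow> s \<le> g x \<Longrightarrow> k x = 1" "\<mu> k \<le> \<mu> g"
proof -
  obtain b where b: "\<mu> g < b" "b < s"
    using dense[OF s] by auto
  obtain k where k: "k \<in> unit_functions X"
      "\<And>x. x \<in> topspace X \<Longrightarrow> s \<le> g x \<Longrightarrow> k x = 1"
      "\<And>x. x \<in> topspace X \<Longrightarrow> g x \<le> b \<Longrightarrow> k x = 0"
    using unit_function_threshold[OF g b(2)] by blast
  have "\<mu> k \<le> \<mu> g"
  proof (cases "b \<le> 1")
    case True
    with b range_bounds[OF g] have b01: "b \<in> {0..1}" by auto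
    have "\<mu> (meet_fun X (const_fun X b) k) \<le> \<mu> g"
    proof (rule \<mu>_mono)
      show "meet_fun X (const_fun X b) k x \<le> g x" if "x \<in> topspace X" for x
        using that k(3)[of x] unit_functionsD(2)[OF g, of x]
        by (cases "g x \<le> b") (auto simp: meet_fun_def const_fun_def min_def)
    qed (intro unit_functions_closure b01 k g)+
    \<comment> \<open>Since \<open>min b (\<mu> k) \<le> \<mu> g < b\<close>, the minimum must be
      \<open>\<mu> k\<close>.\<close>
    then show ?thesis
      using \<mu>_meet[OF b01 k(1)] b by auto
  next
    \<comment> \<open>As \<open>s\<close> may exceed \<open>1\<close>, so may \<open>b\<close>, and
      homogeneity does not apply to it. But then \<open>g \<le> 1 < b\<close> everywhere, so
      \<open>k = 0 \<le> g\<close>.\<close>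
    case False
    then show ?thesis
      using k unit_functionsD[OF k(1)] unit_functionsD[OF g]
      by (intro \<mu>_mono g k(1)) (metis dual_order.trans linorder_le_cases)
  qed
  with k show ?thesis by (intro that) auto
qed

lemma \<nu>_upper_set_le:
  assumes g: "g \<in> unit_functions X" and s: "\<mu> g < s"
  shows "\<nu> {x \<in> topspace X. s \<le> g x} \<le> \<mu> g"
proof -
  obtain k where k: "k \<in> unit_functions X" "\<And>x. x \<in> topspace X \<Longrightarrow> s \<le> g x \<Longrightarrow> k x = 1" "\<mu> k \<le> \<mu> g"
    using threshold_le[OF g s] by blast
  show ?thesis
    using \<nu>_le[OF closedin_upper_set[OF g, of s] k(1)] k by force
qed

text \<open>If a competitor \<open>g\<close> had \<open>\<mu> g < s < \<mu> f\<close>, then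
  \<open>f < \<mu> f\<close> on the compact set where \<open>g \<le> s\<close>, hence
  \<open>f \<le> r\<close> there for some \<open>r < \<mu> f\<close>. Elsewhere the cut-off
  \<open>k\<close> of \<open>g\<close> equals \<open>1\<close>, so \<open>f\<close> lies below
  \<open>max r k\<close>, whose value \<open>max r (\<mu> k)\<close> is less than
  \<open>\<mu> f\<close>.\<close>

lemma le_\<nu>_upper_set:
  assumes f: "f \<in> unit_functions X"
  shows "\<mu> f \<le> \<nu> {x \<in> topspace X. \<mu> f \<le> f x}"
proof (rule \<nu>_greatest)
  show "closedin X {x \<in> topspace X. \<mu> f \<le> f x}"
    by (rule closedin_upper_set[OF f])
next
  fix g assume g: "g \<in> unit_functions X" and g1: "\<And>x. x \<in> {x \<in> topspace X. \<mu> f \<le> f x} \<Longrightarrow> g x = 1"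
  show "\<mu> f \<le> \<mu> g"
  proof (rule ccontr)
    assume less: "\<not> \<mu> f \<le> \<mu> g"
    then obtain s where s: "\<mu> g < s" "s < \<mu> f"
      using dense[of "\<mu> g" "\<mu> f"] by auto
    obtain k where k: "k \<in> unit_functions X"
        "\<And>x. x \<in> topspace X \<Longrightarrow> s \<le> g x \<Longrightarrow> k x = 1" "\<mu> k \<le> \<mu> g"
      using threshold_le[OF g s(1)] by blast
    let ?K = "{x \<in> topspace X. g x \<le> s}"
    \<comment> \<open>Otherwise \<open>g x = 1\<close>, whereas
      \<open>g x \<le> s < \<mu> f \<le> 1\<close>.\<close>
    have less_K: "f x < \<mu> f" if "x \<in> ?K" for x
    proof (rule ccontr)
      assume "\<not> f x < \<mu> f"
      then show False
        using that g1[of x] s range_bounds[OF f] by auto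
    qed
    have "compactin X ?K"
      by (intro closedin_compact_space compact closedin_lower_set g)
    then have cpt: "compact (f ` ?K)"
      using image_compactin unit_functionsD(1)[OF f] by fastforce
    obtain r where r: "r \<in> {0..1}" "r < \<mu> f" "\<And>x. x \<in> ?K \<Longrightarrow> f x \<le> r"
    proof (cases "?K = {}")
      case True
      \<comment> \<open>With no maximum to take, \<open>r = 0\<close> serves, because
        \<open>0 \<le> \<mu> g < \<mu> f\<close>.\<close>
      have "0 < \<mu> f"
        using less range_bounds[OF g] by auto
      with True show ?thesis by (intro that[of 0]) auto
    next
      case False
      then obtain y where y: "y \<in> ?K" "\<forall>z\<in>f ` ?K. z \<le> f y"
        using compact_attains_sup[OF cpt] by auto
      then show ?thesis
        using less_K[OF y(1)] unit_functionsD[OF f] by (intro that[of "f y"]) auto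
    qed
    have "\<mu> f \<le> \<mu> (join_fun X (const_fun X r) k)"
    proof (rule \<mu>_mono)
      show "f x \<le> join_fun X (const_fun X r) k x" if "x \<in> topspace X" for x
        using that r(3)[of x] k(2)[of x] unit_functionsD(3)[OF f that]
        by (cases "g x \<le> s") (auto simp: join_fun_def const_fun_def le_max_iff_disj)
    qed (intro unit_functions_closure r f k)+
    then show False
      using \<mu>_join[OF r(1) k(1)] r(2) k(3) less by auto
  qed
qed

lemma capacity_\<nu>: "capacity X \<nu>"
  unfolding capacity_def
proof (intro conjI allI ballI impI)
  have 1: "1 \<le> \<mu> f" if "f \<in> unit_functions X" "\<And>x. x \<in> topspace X \<Longrightarrow> f x = 1" for f
  proof -
    have "f = const_fun X 1"
      using that const_unit_functions[of 1 X]
      by (intro unit_functions_eqI[of _ X]) (auto simp: const_fun_def)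
    then show ?thesis
      using \<mu>_const[of 1] by simp
  qed
  have ge0: "0 \<le> \<nu> F" if "closedin X F" for F
    using that range_bounds by (intro \<nu>_greatest) auto
  have le1: "\<nu> F \<le> 1" if "closedin X F" for F
  proof -
    have "const_fun X 1 x = 1" if "x \<in> F" for x
      using that closedin_subset[OF \<open>closedin X F\<close>] by (auto simp: const_fun_def)
    then show ?thesis
      using \<nu>_le[OF that const_unit_functions[of 1 X]] \<mu>_const[of 1] by simp
  qed
  show "\<nu> \<in> {F. closedin X F} \<rightarrow>\<^sub>E {0..1}"
    using ge0 le1 by (simp add: PiE_iff) (simp add: induced_capacity_def)
  show "\<nu> (topspace X) = 1"
    by (intro antisym le1 \<nu>_greatest 1) auto
  \<comment> \<open>Every function competes for the empty set, in particular the constant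
    \<open>0\<close>.\<close>
  show "\<nu> {} = 0"
    using \<nu>_le[of "{}" "const_fun X 0"] \<mu>_const[of 0] const_unit_functions[of 0 X] ge0[of "{}"] by auto
  show "\<nu> F \<le> \<nu> G" if "closedin X F \<and> closedin X G \<and> F \<subseteq> G" for F G
    using that \<nu>_mono by auto
  fix F a assume "a \<in> {0..1::real}" and F: "closedin X F \<and> \<nu> F < a"
  then obtain f where f: "f \<in> unit_functions X" "\<And>x. x \<in> F \<Longrightarrow> f x = 1" "\<mu> f < a"
    using \<nu>_greatest[of F a] by (meson not_le)
  \<comment> \<open>The gap below \<open>a\<close> puts \<open>F\<close> inside the open set where
    \<open>b < f\<close>, since \<open>b < a \<le> 1\<close>. The gap above \<open>\<mu> f\<close>
    makes \<open>\<nu>_upper_set_le\<close> applicable to the closed set where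
    \<open>b \<le> f\<close>, which contains every admissible \<open>B\<close>.\<close>
  obtain b where b: "\<mu> f < b" "b < a"
    using dense[OF f(3)] by auto
  show "\<exists>U. openin X U \<and> F \<subseteq> U \<and> (\<forall>B. compactin X B \<and> B \<subseteq> U \<longrightarrow> \<nu> B < a)"
  proof (intro exI[of _ "{x \<in> topspace X. b < f x}"] conjI allI impI)
    show "openin X {x \<in> topspace X. b < f x}"
      by (rule openin_strict_upper_set[OF f(1)])
    show "F \<subseteq> {x \<in> topspace X. b < f x}"
      using F closedin_subset[of X F] f(2) b \<open>a \<in> {0..1}\<close> by auto
    fix B assume B: "compactin X B \<and> B \<subseteq> {x \<in> topspace X. b < f x}"
    then have "\<nu> B \<le> \<nu> {x \<in> topspace X. b \<le> f x}"
      by (intro \<nu>_mono closedin_upper_set f compactin_imp_closedin Hausdorff) auto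
    then show "\<nu> B < a"
      using \<nu>_upper_set_le[OF f(1) b(1)] f(3) by linarith
  qed
qed

text \<open>The maximum is attained at \<open>t = \<mu> f\<close> by
  \<open>le_\<nu>_upper_set\<close>. For \<open>t > \<mu> f\<close> the capacity term is at most
  \<open>\<mu> f\<close>; for smaller \<open>t\<close> the term \<open>t\<close> itself is.\<close>

lemma Sugeno_\<nu>: "is_Sugeno_integral X \<nu> \<mu>"
  unfolding is_Sugeno_integral_def is_maximum_def
proof (intro ballI conjI)
  fix f assume f: "f \<in> unit_functions X"
  note eq = unit_fun_upper_set_eq[OF f]
  show "\<mu> f \<in> (\<lambda>t. min (\<nu> (f -` {t..1} \<inter> topspace X)) t) ` {0..1}"
    using le_\<nu>_upper_set[OF f] range_bounds[OF f] by (intro image_eqI[of _ _ "\<mu> f"]) (auto simp: eq)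
  fix s assume "s \<in> (\<lambda>t. min (\<nu> (f -` {t..1} \<inter> topspace X)) t) ` {0..1}"
  then obtain t where "s = min (\<nu> {x \<in> topspace X. t \<le> f x}) t"
    by (auto simp: eq)
  then show "s \<le> \<mu> f"
    using \<nu>_upper_set_le[OF f, of t] by linarith
qed

end

section \<open>Sugeno integrals\<close>

lemma capacity_mono:
  "capacity X \<nu> \<Longrightarrow> closedin X F \<Longrightarrow> closedin X G \<Longrightarrow> F \<subseteq> G \<Longrightarrow> \<nu> F \<le> \<nu> G"
  unfolding capacity_def by blast

lemma capacity_bounds:
  "capacity X \<nu> \<Longrightarrow> closedin X F \<Longrightarrow> 0 \<le> \<nu> F \<and> \<nu> F \<le> 1"
  unfolding capacity_def by (auto simp: PiE_iff)

lemma Sugeno_attained: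
  assumes "is_Sugeno_integral X \<nu> \<mu>" "f \<in> unit_functions X"
  obtains t where "t \<in> {0..1}" "\<mu> f = min (\<nu> {x \<in> topspace X. t \<le> f x}) t"
  using assms by (auto simp: is_Sugeno_integral_def is_maximum_def unit_fun_upper_set_eq)

lemma Sugeno_ge:
  assumes "is_Sugeno_integral X \<nu> \<mu>" "f \<in> unit_functions X" "t \<in> {0..1}"
  shows "min (\<nu> {x \<in> topspace X. t \<le> f x}) t \<le> \<mu> f"
  using assms by (auto simp: is_Sugeno_integral_def is_maximum_def unit_fun_upper_set_eq)

text \<open>Capacities of upper level sets decrease in the level. The maximum is attained at some
  \<open>u \<ge> \<mu> f\<close>, so \<open>t \<le> \<mu> f\<close> gives \<open>t \<le> u\<close>,
  and the level set at \<open>t\<close> has capacity at least \<open>\<mu> f\<close>.\<close>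

lemma Sugeno_ge_iff:
  assumes \<nu>: "capacity X \<nu>" "is_Sugeno_integral X \<nu> \<mu>"
    and f: "f \<in> unit_functions X" and t: "t \<in> {0..1}"
  shows "t \<le> \<mu> f \<longleftrightarrow> t \<le> \<nu> {x \<in> topspace X. t \<le> f x}"
proof
  assume le: "t \<le> \<mu> f"
  obtain u where u: "u \<in> {0..1}" "\<mu> f = min (\<nu> {x \<in> topspace X. u \<le> f x}) u"
    using Sugeno_attained[OF \<nu>(2) f] .
  with le have "\<nu> {x \<in> topspace X. u \<le> f x} \<le> \<nu> {x \<in> topspace X. t \<le> f x}"
    by (intro capacity_mono[OF \<nu>(1)] closedin_upper_set f) auto
  with u le show "t \<le> \<nu> {x \<in> topspace X. t \<le> f x}" by auto
next
  assume "t \<le> \<nu> {x \<in> topspace X. t \<le> f x}"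
  then show "t \<le> \<mu> f"
    using Sugeno_ge[OF \<nu>(2) f t] by linarith
qed

lemma unit_real_eqI:
  fixes a b :: real
  assumes "a \<in> {0..1}" "b \<in> {0..1}" "\<And>t. t \<in> {0..1} \<Longrightarrow> t \<le> a \<longleftrightarrow> t \<le> b"
  shows "a = b"
  using assms(3)[of a] assms(3)[of b] assms(1,2) by (intro antisym) auto

text \<open>Both sides are compared through the thresholds \<open>t\<close> they reach. By
  \<open>Sugeno_ge_iff\<close> this becomes a computation of level sets: joining or meeting with
  \<open>c\<close> keeps that of \<open>f\<close> or replaces it by the whole space or the empty
  set.\<close>

lemma Sugeno_homogeneous:
  assumes range: "\<mu> \<in> unit_functions X \<rightarrow> {0..1}"
    and \<nu>: "capacity X \<nu>" "is_Sugeno_integral X \<nu> \<mu>"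
  shows "join_homogeneous X \<mu>" and "meet_homogeneous X \<mu>"
proof -
  have \<nu>_ends: "\<nu> (topspace X) = 1" "\<nu> {} = 0"
    using \<nu>(1) by (auto simp: capacity_def)
  note ge_iff = Sugeno_ge_iff[OF \<nu>]
  show "join_homogeneous X \<mu>"
    unfolding join_homogeneous_def
  proof (intro ballI unit_real_eqI)
    fix c f t assume c: "c \<in> {0..1::real}" and f: "f \<in> unit_functions X" and t: "t \<in> {0..1::real}"
    let ?g = "join_fun X (const_fun X c) f"
    have g: "?g \<in> unit_functions X" by (intro unit_functions_closure c f)
    have "{x \<in> topspace X. t \<le> ?g x} =
        (if t \<le> c then topspace X else {x \<in> topspace X. t \<le> f x})"
      by (auto simp: join_fun_def const_fun_def)
    then show "t \<le> \<mu> ?g \<longleftrightarrow> t \<le> max c (\<mu> f)"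
      using ge_iff[OF g t] ge_iff[OF f t] \<nu>_ends t by (auto simp: le_max_iff_disj)
  next
    fix c f assume c: "c \<in> {0..1::real}" and f: "f \<in> unit_functions X"
    show "\<mu> (join_fun X (const_fun X c) f) \<in> {0..1}"
      by (intro funcset_mem[OF range] unit_functions_closure c f)
    show "max c (\<mu> f) \<in> {0..1}"
      using funcset_mem[OF range f] c by auto
  qed
  show "meet_homogeneous X \<mu>"
    unfolding meet_homogeneous_def
  proof (intro ballI unit_real_eqI)
    fix c f t assume c: "c \<in> {0..1::real}" and f: "f \<in> unit_functions X" and t: "t \<in> {0..1::real}"
    let ?g = "meet_fun X (const_fun X c) f"
    have g: "?g \<in> unit_functions X" by (intro unit_functions_closure c f)
    have "{x \<in> topspace X. t \<le> ?g x} =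
        (if t \<le> c then {x \<in> topspace X. t \<le> f x} else {})"
      by (auto simp: meet_fun_def const_fun_def)
    \<comment> \<open>For \<open>t > c\<close> both sides fail: \<open>t > 0\<close> because
      \<open>c \<ge> 0\<close>, while the empty set has capacity \<open>0\<close>.\<close>
    then show "t \<le> \<mu> ?g \<longleftrightarrow> t \<le> min c (\<mu> f)"
      using ge_iff[OF g t] ge_iff[OF f t] \<nu>_ends t c by auto
  next
    fix c f assume c: "c \<in> {0..1::real}" and f: "f \<in> unit_functions X"
    show "\<mu> (meet_fun X (const_fun X c) f) \<in> {0..1}"
      by (intro funcset_mem[OF range] unit_functions_closure c f)
    show "min c (\<mu> f) \<in> {0..1}"
      using funcset_mem[OF range f] c by auto
  qed
qed

text \<open>Used in both directions, this gives uniqueness. If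
  \<open>\<nu>' F < \<nu> F = a\<close>, semicontinuity keeps \<open>\<nu>'\<close> below
  \<open>a\<close> on compact subsets of a neighbourhood \<open>U\<close> of \<open>F\<close>. A
  Urysohn function that is \<open>1\<close> on \<open>F\<close> and \<open>0\<close> off
  \<open>U\<close> then has integral at least \<open>a\<close> for \<open>\<nu>\<close> but below
  \<open>a\<close> for \<open>\<nu>'\<close>.\<close>

lemma Sugeno_capacity_le:
  assumes "compact_space X" "Hausdorff_space X"
    and \<nu>: "capacity X \<nu>" "is_Sugeno_integral X \<nu> \<mu>"
    and \<nu>': "capacity X \<nu>'" "is_Sugeno_integral X \<nu>' \<mu>"
    and F: "closedin X F"
  shows "\<nu> F \<le> \<nu>' F"
proof (rule ccontr)
  assume less: "\<not> \<nu> F \<le> \<nu>' F"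
  define a where "a = \<nu> F"
  have a: "a \<in> {0..1}" "0 < a" "\<nu>' F < a"
    using less capacity_bounds[OF \<nu>(1) F] capacity_bounds[OF \<nu>'(1) F] by (auto simp: a_def)
  then obtain U where U: "openin X U" "F \<subseteq> U" "\<And>B. compactin X B \<Longrightarrow> B \<subseteq> U \<Longrightarrow> \<nu>' B < a"
    using \<nu>'(1) F unfolding capacity_def by metis
  have "normal_space X"
    using assms(1,2) compact_Hausdorff_or_regular_imp_normal_space by blast
  then obtain g where g: "continuous_map X (top_of_set {0..1::real}) g"
      "g ` (topspace X - U) \<subseteq> {0}" "g ` F \<subseteq> {1}"
    using Urysohn_lemma[of X "topspace X - U" F 0 1] F U by (auto simp: disjnt_def)
  define f where "f = restrict g (topspace X)"
  have f: "f \<in> unit_functions X"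
    unfolding f_def using g(1)
    by (intro restrict_unit_functions) (auto simp: continuous_map_in_subtopology)
  have f1: "f x = 1" if "x \<in> F" for x
    using that g(3) closedin_subset[OF F] by (auto simp: f_def)
  have f0: "f x = 0" if "x \<in> topspace X" "x \<notin> U" for x
    using that g(2) by (auto simp: f_def)
  have "\<nu> F \<le> \<nu> {x \<in> topspace X. 1 \<le> f x}"
    using closedin_subset[OF F] f1 by (intro capacity_mono[OF \<nu>(1)] closedin_upper_set f F) force
  then have "a \<le> \<mu> f"
    using Sugeno_ge[OF \<nu>(2) f, of 1] a(1) by (auto simp: a_def)
  obtain t where t: "t \<in> {0..1}" "\<mu> f = min (\<nu>' {x \<in> topspace X. t \<le> f x}) t"
    using Sugeno_attained[OF \<nu>'(2) f] .
  have "\<nu>' {x \<in> topspace X. t \<le> f x} < a"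
  proof (rule U(3))
    show "compactin X {x \<in> topspace X. t \<le> f x}"
      by (intro closedin_compact_space assms(1) closedin_upper_set f)
    \<comment> \<open>The level set at \<open>0\<close> is the whole space and need not lie in
      \<open>U\<close>; this level is excluded by
      \<open>t \<ge> \<mu> f \<ge> a > 0\<close>.\<close>
    have "0 < t"
      using t \<open>a \<le> \<mu> f\<close> a(2) by auto
    then show "{x \<in> topspace X. t \<le> f x} \<subseteq> U"
      using f0 by force
  qed
  with t \<open>a \<le> \<mu> f\<close> show False by auto
qed

theorem theorem1:
  fixes X :: "'a topology" and \<mu> :: "('a \<Rightarrow> real) \<Rightarrow> real"
  assumes "compact_space X" and "Hausdorff_space X"
    and "\<mu> \<in> unit_functions X \<rightarrow> {0..1}"
  shows "join_homogeneous X \<mu> \<and> meet_homogeneous X \<mu> \<longleftrightarrow>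
    (\<exists>!\<nu>. capacity X \<nu> \<and> is_Sugeno_integral X \<nu> \<mu>)"
proof
  assume "join_homogeneous X \<mu> \<and> meet_homogeneous X \<mu>"
  then interpret homogeneous_functional X \<mu>
    using assms by unfold_locales auto
  show "\<exists>!\<nu>. capacity X \<nu> \<and> is_Sugeno_integral X \<nu> \<mu>"
  proof (rule ex1I)
    show "capacity X \<nu> \<and> is_Sugeno_integral X \<nu> \<mu>"
      using capacity_\<nu> Sugeno_\<nu> by simp
    fix \<nu>' assume \<nu>': "capacity X \<nu>' \<and> is_Sugeno_integral X \<nu>' \<mu>"
    show "\<nu>' = \<nu>"
    proof (rule extensionalityI)
      show "\<nu>' \<in> extensional {F. closedin X F}" "\<nu> \<in> extensional {F. closedin X F}"
        using \<nu>' capacity_\<nu> by (auto simp: capacity_def PiE_iff)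
      show "\<nu>' F = \<nu> F" if "F \<in> {F. closedin X F}" for F
        using that Sugeno_capacity_le[OF assms(1,2)] \<nu>' capacity_\<nu> Sugeno_\<nu>
        by (intro antisym) auto
    qed
  qed
next
  assume "\<exists>!\<nu>. capacity X \<nu> \<and> is_Sugeno_integral X \<nu> \<mu>"
  then show "join_homogeneous X \<mu> \<and> meet_homogeneous X \<mu>"
    using Sugeno_homogeneous[OF assms(3)] by blast
qed

end
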